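(* Let $V=\{0,\mathbf{v}_1,\dots,\mathbf{v}_{q-1}\}\subset\mathbb{Z}^n$ with $|V|=q$ prime, and suppose $\mathbf{v}_1,\dots,\mathbf{v}_{q-1}$ generate $\mathbb{Z}^n$ as a group. Then there exists a tiling of $\mathbb{Z}^n$ by translates of $V$ if and only if there exists a lattice tiling of $\mathbb{Z}^n$ by translates of $V$.
   Context: A tiling of $\mathbb{Z}^n$ by translates of $V$ is a family $\{V+l: l\in\mathcal{L}\}$, $\mathcal{L}\subset\mathbb{Z}^n$, such that every $x\in\mathbb{Z}^n$ can be written uniquely as $x=v+l$ with $v\in V$, $l\in\mathcal{L}$. It is a lattice tiling if $\mathcal{L}$ is a subgroup of $\mathbb{Z}^n$. *)

theory Defs
  imports
    "HOL-Analysis.Finite_Cartesian_Product"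
    "HOL-Computational_Algebra.Primes"
    "HOL-Computational_Algebra.Group_Closure"
begin

definition tiling :: "'a::ab_group_add set \<Rightarrow> 'a set \<Rightarrow> bool" where
  "tiling V L \<longleftrightarrow> (\<forall>x. \<exists>!p. p \<in> V \<times> L \<and> x = fst p + snd p)"

definition add_subgroup :: "'a::ab_group_add set \<Rightarrow> bool" where
  "add_subgroup L \<longleftrightarrow>
     0 \<in> L \<and> (\<forall>x\<in>L. \<forall>y\<in>L. x + y \<in> L) \<and> (\<forall>x\<in>L. - x \<in> L)"

definition lattice_tiling :: "'a::ab_group_add set \<Rightarrow> 'a set \<Rightarrow> bool" where
  "lattice_tiling V L \<longleftrightarrow> tiling V L \<and> add_subgroup L"

end

theory Submission
  imports
    Defs
    Complex_Main
    "HOL-Computational_Algebra.Polynomial_Factorial"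
    "HOL-Library.Poly_Mapping"
begin

text \<open>
  Let \<open>V + L\<close> be a tiling. In the group ring, the power \<open>V\<^sup>q\<close> is congruent modulo \<open>q\<close> to the dilate
  \<open>qV\<close>, while its convolution with \<open>L\<close> is the constant \<open>q^(q-1)\<close>. Hence for every \<open>y\<close> the number of
  \<open>v \<in> V\<close> with \<open>y - qv \<in> L\<close> is \<open>0\<close> or \<open>q\<close>, so \<open>L\<close> is invariant under \<open>qV\<close>; as \<open>V\<close> generates,
  \<open>L\<close> is periodic modulo \<open>q\<close>.

  On the finite group \<open>(\<int>/q)^n\<close> the Fourier transforms of \<open>V\<close> and \<open>L\<close> multiply to zero at every
  nontrivial character. The transform of \<open>L\<close> cannot vanish at all of them, since \<open>L\<close> has density
  \<open>1/q\<close>, so that of \<open>V\<close> vanishes at some character \<open>x \<mapsto> \<zeta>^(a\<bullet>x)\<close>. By irreducibility of the cyclotomic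
  polynomial (Eisenstein) a vanishing sum of \<open>q\<close> powers of \<open>\<zeta>\<close> contains each power exactly once;
  thus \<open>x \<mapsto> a\<bullet>x mod q\<close> is bijective on \<open>V\<close> and its kernel is a lattice tiling set.
\<close>

section \<open>Integer relations among roots of unity of prime order\<close>

text \<open>Exactly one of the two constant terms is divisible by \<open>q\<close>, since
  \<open>q\<close> but not its square divides their product. The conclusion speaks of degrees, not
  units, because \<open>F * G\<close> need not be primitive.\<close>

lemma eisenstein_degree:
  fixes F G :: "int poly" and q :: int
  assumes q: "prime q"
    and lead: "\<not> q dvd lead_coeff (F * G)"
    and low: "\<And>i. i < degree (F * G) \<Longrightarrow> q dvd coeff (F * G) i"
    and const: "\<not> q\<^sup>2 dvd coeff (F * G) 0"
  shows "degree F = 0 \<or> degree G = 0"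
proof (rule ccontr)
  assume "\<not> ?thesis"
  then have dF: "degree F > 0" and dG: "degree G > 0" by auto
  have not_both: "False" if dvds: "q dvd coeff A 0" and ndvd: "\<not> q dvd coeff B 0"
    and AB: "A * B = F * G" and dB: "degree B > 0" for A B :: "int poly"
  proof -
    have nz: "A \<noteq> 0" "B \<noteq> 0" using AB lead by auto
    have "\<not> q dvd lead_coeff A"
      using lead by (auto simp: AB[symmetric] lead_coeff_mult)
    then have ex: "\<exists>i. \<not> q dvd coeff A i" by blast
    define i where "i = (LEAST i. \<not> q dvd coeff A i)"
    have i: "\<not> q dvd coeff A i" unfolding i_def using ex by (rule LeastI_ex)
    have less: "q dvd coeff A j" if "j < i" for j
      using not_less_Least[of j "\<lambda>i. \<not> q dvd coeff A i"] that i_def by auto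
    \<comment> \<open>As \<open>B\<close> is nonconstant, \<open>i\<close> lies strictly below the
      degree of the product, where \<open>low\<close> applies. In coefficient \<open>i\<close> only
      the term \<open>coeff A i * coeff B 0\<close> is not already known to be divisible by
      \<open>q\<close>.\<close>
    have "i \<le> degree A" using i by (metis dvd_0_right le_degree)
    also have "\<dots> < degree (A * B)" using nz dB by (simp add: degree_mult_eq)
    finally have "q dvd coeff (A * B) i" using low AB by metis
    moreover have "coeff (A * B) i = coeff A i * coeff B 0 + (\<Sum>j<i. coeff A j * coeff B (i - j))"
      by (simp add: coeff_mult lessThan_Suc_atMost[symmetric])
    moreover have "q dvd (\<Sum>j<i. coeff A j * coeff B (i - j))"
      by (intro dvd_sum dvd_mult2) (auto intro: less)
    ultimately have "q dvd coeff A i * coeff B 0"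
      by (simp add: dvd_add_left_iff)
    then show False using i ndvd q by (simp add: prime_dvd_mult_iff)
  qed
  have "q dvd coeff (F * G) 0" using low dF dG
    by (metis degree_0 degree_mult_eq gr_zeroI not_gr0 add_gr_0)
  then have "q dvd coeff F 0 \<or> q dvd coeff G 0"
    using q by (simp add: coeff_mult prime_dvd_mult_iff)
  moreover have "\<not> (q dvd coeff F 0 \<and> q dvd coeff G 0)"
    using const by (auto simp: coeff_mult power2_eq_square mult_dvd_mono)
  ultimately show False
    using not_both[of F G] not_both[of G F] dF dG by (auto simp: mult.commute)
qed

text \<open>This is the cyclotomic polynomial of index \<open>q\<close> only when \<open>q\<close> is prime.\<close>

definition cyclotomic_prime :: "nat \<Rightarrow> int poly" where
  "cyclotomic_prime q = (\<Sum>i<q. monom 1 i)"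

lemma coeff_cyclotomic_prime: "coeff (cyclotomic_prime q) i = (if i < q then 1 else 0)"
  by (simp add: cyclotomic_prime_def coeff_sum)

lemma degree_cyclotomic_prime: "degree (cyclotomic_prime q) = q - 1"
proof (cases "q = 0")
  case False
  then show ?thesis
    by (intro antisym degree_le le_degree) (auto simp: coeff_cyclotomic_prime)
qed (simp add: cyclotomic_prime_def)

text \<open>Substituting X + 1 for X turns the geometric sum identity into X P(X + 1) = (X + 1)^q -
  1; dividing by X accounts for the index \<open>Suc i\<close>. In this form Eisenstein applies when
  \<open>q\<close> is prime.\<close>

lemma coeff_cyclotomic_prime_shift:
  "coeff (pcompose (cyclotomic_prime q) [:1, 1:]) i = int (q choose Suc i)"
proof -
  have geom: "(monom 1 1 - 1) * cyclotomic_prime q = monom 1 q - 1"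
    using power_diff_1_eq[of "monom (1::int) 1" q]
    by (simp add: cyclotomic_prime_def monom_power)
  have "pcompose (monom 1 n) [:1, 1:] = [:1, 1:: int:] ^ n" for n
    by (induction n) (simp_all add: monom_Suc pcompose_pCons monom_0 pcompose_1)
  note pow = this
  have "pcompose (monom 1 1 - 1) [:1, 1:] = [:0, 1::int:]"
    by (simp add: pcompose_diff pow pcompose_1 one_pCons)
  then have "[:0, 1:] * pcompose (cyclotomic_prime q) [:1, 1:] = [:1, 1:] ^ q - 1"
    using arg_cong[OF geom, of "\<lambda>p. pcompose p [:1, 1:]"]
    by (simp add: pcompose_mult pcompose_diff pow pcompose_1)
  from arg_cong[OF this, of "\<lambda>p. coeff p (Suc i)"]
  show ?thesis by (cases "Suc i \<le> q") (simp_all add: coeff_linear_poly_power coeff_eq_0 degree_linear_power binomial_eq_0)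
qed

text \<open>The shift preserves degrees, so Eisenstein makes one factor constant; since the
  polynomial is monic, that constant is a unit.\<close>

lemma irreducible_cyclotomic_prime:
  assumes "prime q"
  shows "irreducible (cyclotomic_prime q)"
proof (rule irreducibleI)
  let ?P = "cyclotomic_prime q"
  have q2: "q \<ge> 2" using assms by (rule prime_ge_2_nat)
  have lead: "lead_coeff ?P = 1"
    using q2 by (simp add: degree_cyclotomic_prime coeff_cyclotomic_prime)
  show "?P \<noteq> 0" using lead by auto
  show "\<not> ?P dvd 1"
    using q2 by (auto simp: degree_cyclotomic_prime dest!: dvd_imp_degree_le)
  fix F G assume FG: "?P = F * G"
  let ?F = "pcompose F [:1, 1:]" and ?G = "pcompose G [:1, 1:]"
  have eq: "?F * ?G = pcompose ?P [:1, 1:]" by (simp add: FG pcompose_mult)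
  have deg: "degree (?F * ?G) = q - 1"
    by (simp add: eq degree_pcompose degree_cyclotomic_prime)
  have "degree ?F = 0 \<or> degree ?G = 0"
  proof (rule eisenstein_degree[of "int q"])
    show "prime (int q)" using assms by simp
    show "\<not> int q dvd lead_coeff (?F * ?G)"
      unfolding deg using q2 by (simp add: eq coeff_cyclotomic_prime_shift)
    show "int q dvd coeff (?F * ?G) i" if "i < degree (?F * ?G)" for i
      using that unfolding deg unfolding eq coeff_cyclotomic_prime_shift
      by (simp add: dvd_choose_prime assms)
    \<comment> \<open>The constant coefficient of the shifted polynomial is
      \<open>q choose 1\<close>, that is \<open>q\<close> itself.\<close>
    have "\<not> q\<^sup>2 dvd q" using q2 by (auto dest!: dvd_imp_le simp: power2_eq_square)
    then show "\<not> (int q)\<^sup>2 dvd coeff (?F * ?G) 0"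
      unfolding eq coeff_cyclotomic_prime_shift using q2
      by (simp flip: of_nat_power)
  qed
  then have "degree F = 0 \<or> degree G = 0" by (simp add: degree_pcompose)
  moreover have "A dvd 1" if "degree A = 0" "A dvd ?P" for A
  proof -
    from that(1) obtain c where c: "A = [:c:]" by (rule degree_eq_zeroE)
    have "c dvd 1" using that(2) lead unfolding c by (metis const_poly_dvd_iff)
    then show ?thesis by (simp add: c is_unit_const_poly_iff)
  qed
  ultimately show "F dvd 1 \<or> G dvd 1" using FG by auto
qed

section \<open>Integer polynomials vanishing at a given point\<close>

lemma poly_of_int_add:
  "poly (map_poly of_int (f + g)) x = poly (map_poly of_int f) x + poly (map_poly of_int g) (x :: 'a :: comm_ring_1)"
proof -
  have "map_poly of_int (f + g) = map_poly of_int f + (map_poly of_int g :: 'a poly)"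
    by (rule poly_eqI) (simp add: coeff_map_poly)
  then show ?thesis by simp
qed

lemma poly_of_int_mult:
  "poly (map_poly of_int (f * g)) x = poly (map_poly of_int f) x * poly (map_poly of_int g) (x :: 'a :: comm_ring_1)"
proof -
  have "map_poly of_int (f * g) = map_poly of_int f * (map_poly of_int g :: 'a poly)"
    by (rule poly_eqI) (simp add: coeff_map_poly coeff_mult)
  then show ?thesis by simp
qed

text \<open>If \<open>f\<close> were nonzero, take \<open>g\<close> of least degree among nonzero
  integer polynomials vanishing at \<open>x\<close>. Pseudo-division stays over the integers and, by
  minimality, gives \<open>c P = g h\<close>. As \<open>P\<close> is prime in Z[X], it divides
  \<open>g\<close>, against the degree bound, or \<open>h\<close>; in the latter case cancelling
  \<open>P\<close> makes \<open>g\<close> a nonzero constant, which cannot vanish at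
  \<open>x\<close>.\<close>

lemma irreducible_int_poly_root_degree:
  fixes P f :: "int poly" and x :: "'a :: field_char_0"
  assumes irr: "irreducible P"
    and P: "poly (map_poly of_int P) x = 0"
    and f: "poly (map_poly of_int f) x = 0"
    and deg: "degree f < degree P"
  shows "f = 0"
proof (rule ccontr)
  assume "f \<noteq> 0"
  define S where "S = {g. g \<noteq> 0 \<and> poly (map_poly of_int g) x = 0}"
  have "f \<in> S" using \<open>f \<noteq> 0\<close> f by (simp add: S_def)
  then obtain g where g: "g \<in> S" and min: "\<And>h. h \<in> S \<Longrightarrow> degree g \<le> degree h"
    using ex_has_least_nat[of "\<lambda>h. h \<in> S" f degree] by blast
  have g0: "g \<noteq> 0" and gx: "poly (map_poly of_int g) x = 0" using g by (auto simp: S_def)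
  obtain h r where hr: "pseudo_divmod P g = (h, r)" by fastforce
  define c where "c = coeff g (degree g) ^ (Suc (degree P) - degree g)"
  have c0: "c \<noteq> 0" using g0 by (simp add: c_def)
  have eq: "smult c P = g * h + r" and r: "r = 0 \<or> degree r < degree g"
    using pseudo_divmod[OF g0 hr] by (auto simp: c_def)
  have "poly (map_poly of_int ([:c:] * P)) x = 0"
    using P by (simp only: poly_of_int_mult) simp
  then have "poly (map_poly of_int r) x = 0"
    using gx eq by (simp add: poly_of_int_add poly_of_int_mult)
  then have "r = 0" using r min[of r] unfolding S_def by fastforce
  then have eq: "[:c:] * P = g * h" using eq by simp
  have "prime_elem P" using irr by (rule irreducible_imp_prime_elem)
  then have "P dvd g \<or> P dvd h"
    using eq by (metis dvd_triv_right prime_elem_dvd_mult_iff)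
  then show False
  proof
    assume "P dvd g"
    then have "degree P \<le> degree g" using g0 by (rule dvd_imp_degree_le)
    then show False using min[OF \<open>f \<in> S\<close>] deg by simp
  next
    assume "P dvd h"
    then obtain k where k: "h = P * k" ..
    have "P \<noteq> 0" using irr by auto
    moreover have "P * [:c:] = P * (g * k)" using eq k by (metis mult.commute mult.left_commute)
    ultimately have gk: "[:c:] = g * k" by (metis mult_left_cancel)
    then have "degree g = 0" using c0 
      by (metis degree_mult_eq_0 degree_pCons_0 mult_eq_0_iff pCons_eq_0_iff)
    then obtain d where "g = [:d:]" by (rule degree_eq_zeroE)
    then show False using gx g0 by (simp add: map_poly_pCons)
  qed
qed

lemma cis_root_of_unity_sum_zero:
  assumes "q > 1"
  shows "(\<Sum>i<q. cis (2 * pi / real q) ^ i) = 0"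
proof -
  let ?z = "cis (2 * pi / real q)"
  have "?z \<noteq> 1"
  proof
    assume "?z = 1"
    then have "cos (2 * pi / real q) = 1" by (simp add: complex_eq_iff)
    then obtain n :: int where "2 * pi / real q = of_int n * 2 * pi"
      using cos_one_2pi_int[of "2 * pi / real q"] by auto
    then have "1 = real_of_int n * real q" using assms by (simp add: field_simps)
    then have "1 = n * int q" by (metis of_int_1 of_int_eq_iff of_int_mult of_int_of_nat_eq)
    then show False using assms by (metis zdvd1_eq dvd_triv_right abs_of_nat less_irrefl of_nat_1_eq_iff)
  qed
  moreover have "?z ^ q = 1" using assms by (simp add: DeMoivre)
  ultimately show ?thesis by (simp add: geometric_sum)
qed

text \<open>Subtracting \<open>c (q - 1)\<close> times the vanishing sum of all powers removes the
  top coefficient. What remains has degree below that of the irreducible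
  \<open>cyclotomic_prime q\<close>, so it is zero.\<close>

lemma vanishing_sum_prime_roots_of_unity:
  fixes c :: "nat \<Rightarrow> int"
  assumes q: "prime q"
    and sum: "(\<Sum>i<q. of_int (c i) * cis (2 * pi / real q) ^ i) = 0"
    and i: "i < q"
  shows "c i = c (q - 1)"
proof -
  let ?z = "cis (2 * pi / real q)"
  have q2: "q \<ge> 2" using q by (rule prime_ge_2_nat)
  have ev: "poly (map_poly of_int (\<Sum>i<q. monom (d i) i)) ?z = (\<Sum>i<q. of_int (d i) * ?z ^ i)"
    for d :: "nat \<Rightarrow> int"
  proof -
    have "map_poly of_int (\<Sum>i<q. monom (d i) i) = (\<Sum>i<q. monom (of_int (d i) :: complex) i)"
      by (rule poly_eqI) (simp add: coeff_map_poly coeff_sum if_distrib cong: if_cong)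
    then show ?thesis by (simp add: poly_sum poly_monom)
  qed
  have zero: "(\<Sum>i<q. ?z ^ i) = 0" using q2 by (intro cis_root_of_unity_sum_zero) simp
  define f where "f = (\<Sum>i<q. monom (c i - c (q - 1)) i)"
  have coeff: "coeff f j = (if j < q then c j - c (q - 1) else 0)" for j
    by (simp add: f_def coeff_sum)
  have "f = 0"
  proof (rule irreducible_int_poly_root_degree)
    show "irreducible (cyclotomic_prime q)" using q by (rule irreducible_cyclotomic_prime)
    show "poly (map_poly of_int (cyclotomic_prime q)) ?z = 0"
      using ev[of "\<lambda>_. 1"] zero by (simp add: cyclotomic_prime_def)
    show "poly (map_poly of_int f) ?z = 0"
      using sum zero unfolding f_def ev
      by (simp add: algebra_simps sum_subtractf flip: sum_distrib_left)
    have "degree f \<le> q - 2"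
    proof (intro degree_le allI impI)
      fix j assume "q - 2 < j"
      then have "j = q - 1 \<or> \<not> j < q" by auto
      then show "coeff f j = 0" by (auto simp: coeff)
    qed
    then show "degree f < degree (cyclotomic_prime q)"
      using q2 by (simp add: degree_cyclotomic_prime)
  qed
  then show ?thesis using coeff[of i] i by simp
qed

section \<open>Periodicity of tilings by sets of prime size\<close>

text \<open>Frobenius modulo \<open>q\<close>: the inner binomial coefficients are divisible by
  \<open>q\<close>, and induction extends this from two summands to a finite sum.\<close>

lemma prime_dvd_power_sum_diff:
  fixes f :: "'b \<Rightarrow> 'a :: comm_ring_1"
  assumes q: "prime q" and "finite S"
  shows "\<exists>r. (\<Sum>v\<in>S. f v) ^ q = (\<Sum>v\<in>S. f v ^ q) + of_nat q * r"
  using \<open>finite S\<close>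
proof (induction rule: finite_induct)
  case empty
  then show ?case using prime_gt_0_nat[OF q] by (auto intro: exI[of _ 0] simp: power_0_left)
next
  case (insert v S)
  then obtain r where r: "(\<Sum>v\<in>S. f v) ^ q = (\<Sum>v\<in>S. f v ^ q) + of_nat q * r" by blast
  define a b where "a = f v" and "b = (\<Sum>v\<in>S. f v)"
  define t where "t k = of_nat (q choose k) * a ^ k * b ^ (q - k)" for k
  have q0: "q > 0" using prime_gt_0_nat[OF q] .
  have "(a + b) ^ q = (\<Sum>k\<le>q. t k)"
    unfolding t_def by (rule binomial_ring)
  also have "{..q} = insert 0 (insert q {1..<q})" using q0 by auto
  also have "sum t \<dots> = b ^ q + (a ^ q + sum t {1..<q})"
    using q0 by (simp add: t_def)
  also have "sum t {1..<q} = of_nat q * (\<Sum>k=1..<q. of_nat ((q choose k) div q) * a ^ k * b ^ (q - k))"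
    unfolding sum_distrib_left
  proof (rule sum.cong)
    fix k assume "k \<in> {1..<q}"
    then have "q dvd (q choose k)" using q by (intro dvd_choose_prime) auto
    then have "q choose k = q * ((q choose k) div q)" by simp
    then have "of_nat (q choose k) = (of_nat q * of_nat ((q choose k) div q) :: 'a)"
      by (metis of_nat_mult)
    then show "t k = of_nat q * (of_nat ((q choose k) div q) * a ^ k * b ^ (q - k))"
      by (simp add: t_def mult.assoc)
  qed simp
  finally obtain s where "(a + b) ^ q = b ^ q + (a ^ q + of_nat q * s)" by blast
  then have "(\<Sum>v\<in>insert v S. f v) ^ q = (\<Sum>v\<in>insert v S. f v ^ q) + of_nat q * (r + s)"
    using insert r by (simp add: a_def b_def algebra_simps)
  then show ?case ..
qed

text \<open>Finitely supported maps form the integral group ring, with convolution as product. The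
  function \<open>g\<close> may have infinite support, as the indicator of a tiling set can; such
  functions form a module over that ring.\<close>

definition convolve :: "('a::ab_group_add \<Rightarrow> int) \<Rightarrow> ('a \<Rightarrow>\<^sub>0 int) \<Rightarrow> 'a \<Rightarrow> int" where
  "convolve g P y = (\<Sum>k\<in>Poly_Mapping.keys P. Poly_Mapping.lookup P k * g (y - k))"

lemma convolve_0 [simp]: "convolve g 0 y = 0"
  by (simp add: convolve_def)

lemma convolve_add: "convolve g (P + Q) y = convolve g P y + convolve g Q y"
  unfolding convolve_def
  by (rule setsum_keys_plus_distrib) (simp_all add: algebra_simps)

lemma convolve_diff: "convolve g (P - Q) y = convolve g P y - convolve g Q y"
  using convolve_add[of g "P - Q" Q y] by simp

lemma convolve_sum: "convolve g (\<Sum>i\<in>I. P i) y = (\<Sum>i\<in>I. convolve g (P i) y)"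
  by (induction I rule: infinite_finite_induct) (simp_all add: convolve_add)

lemma convolve_of_nat_mult: "convolve g (of_nat n * P) y = int n * convolve g P y"
  by (induction n) (simp_all add: convolve_add algebra_simps)

lemma convolve_single: "convolve g (Poly_Mapping.single k 1) y = g (y - k)"
  by (simp add: convolve_def)

text \<open>This is the module law for a basis element; additivity in \<open>P\<close> reduces it to
  \<open>P\<close> being a basis element too.\<close>

lemma convolve_single_mult:
  "convolve g (Poly_Mapping.single v 1 * P) y = convolve g P (y - v)"
proof -
  have "Poly_Mapping.keys P \<subseteq> UNIV" by simp
  then show ?thesis
  proof (induction P rule: frag_induction)
    case (one k)
    then show ?case
      by (simp add: mult_single convolve_single algebra_simps)
  qed (simp_all add: convolve_diff right_diff_distrib)
qed

lemma single_power:
  "Poly_Mapping.single (v :: 'a :: ab_group_add) (1 :: int) ^ n = Poly_Mapping.single (\<Sum>i<n. v) 1"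
  by (induction n) (simp_all add: mult_single add.commute)

text \<open>In this form the tiling says that the indicators of \<open>V\<close> and
  \<open>L\<close> convolve to the constant 1, as both the group ring and the Fourier arguments
  require.\<close>

lemma tiling_card_translate:
  assumes "tiling V L"
  shows "card {v \<in> V. y - v \<in> L} = 1"
proof -
  from assms obtain p where p: "p \<in> V \<times> L" "y = fst p + snd p"
    and uniq: "\<And>p'. p' \<in> V \<times> L \<Longrightarrow> y = fst p' + snd p' \<Longrightarrow> p' = p"
    unfolding tiling_def by metis
  have "{v \<in> V. y - v \<in> L} = {fst p}"
  proof (intro equalityI subsetI)
    fix v assume "v \<in> {v \<in> V. y - v \<in> L}"
    then show "v \<in> {fst p}" using uniq[of "(v, y - v)"] by auto
  qed (use p in auto)
  then show ?thesis by simp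
qed

text \<open>The multiple \<open>q v\<close> is written \<open>\<Sum>i<q. v\<close>, as an abelian group carries no scalar action here.\<close>

lemma tiling_prime_dilate:
  fixes V L :: "'a :: ab_group_add set"
  assumes tiling: "tiling V L" and q: "prime q" and V: "finite V" "card V = q"
  shows "q dvd card {v \<in> V. y - (\<Sum>i<q. v) \<in> L}"
proof -
  define g where "g x = (if x \<in> L then 1 else 0 :: int)" for x
  have sum_g: "(\<Sum>v\<in>V. g (y - h v)) = int (card {v \<in> V. y - h v \<in> L})" for h y
    using V(1) by (simp add: g_def sum.If_cases Int_def)
  define P where "P = (\<Sum>v\<in>V. Poly_Mapping.single v (1 :: int))"
  \<comment> \<open>The exponents differ by one: the first factor turns the indicator of
    \<open>L\<close> into the constant 1, and each further factor multiplies a constant by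
    \<open>card V\<close>.\<close>
  have pow: "convolve g (P ^ Suc k) y = int q ^ k" for k y
  proof (induction k arbitrary: y)
    case 0
    have "convolve g P y = int (card {v \<in> V. y - v \<in> L})"
      by (simp add: P_def convolve_sum convolve_single sum_g)
    then show ?case by (simp add: tiling_card_translate[OF tiling])
  next
    case (Suc k)
    have "convolve g (P * P ^ Suc k) y = (\<Sum>v\<in>V. convolve g (P ^ Suc k) (y - v))"
      unfolding P_def sum_distrib_right
      by (simp only: convolve_sum convolve_single_mult)
    also have "\<dots> = int q * int q ^ k" by (simp only: Suc.IH) (simp add: V)
    finally show ?case by simp
  qed
  obtain r where "P ^ q = (\<Sum>v\<in>V. Poly_Mapping.single v 1 ^ q) + of_nat q * r"
    using prime_dvd_power_sum_diff[OF q V(1), of "\<lambda>v. Poly_Mapping.single v 1"]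
    unfolding P_def by blast
  then have "convolve g (P ^ q) y = int (card {v \<in> V. y - (\<Sum>i<q. v) \<in> L}) + int q * convolve g r y"
    by (simp add: convolve_add convolve_sum single_power convolve_single sum_g convolve_of_nat_mult)
  \<comment> \<open>Since \<open>q\<close> is at least 2, the value \<open>q ^ (q - 1)\<close> has a
    positive exponent and is divisible by \<open>q\<close>.\<close>
  moreover obtain k where k: "q = Suc (Suc k)"
    using prime_ge_2_nat[OF q] by (metis add_2_eq_Suc le_Suc_ex)
  then have "int q dvd convolve g (P ^ q) y"
    using pow[of "Suc k" y] by simp
  ultimately show ?thesis by (simp add: dvd_add_left_iff)
qed

text \<open>A count divisible by \<open>q\<close> within a set of size \<open>q\<close> is 0 or
  \<open>q\<close>, so one hit forces all. Comparing the hits at 0 and at \<open>s\<close> makes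
  \<open>q s\<close> a period for \<open>s\<close> in \<open>V\<close>, and periods are closed under
  differences.\<close>

lemma tiling_prime_periodic:
  fixes V L :: "'a :: ab_group_add set"
  assumes tiling: "tiling V L" and q: "prime q" and V: "finite V" "card V = q"
    and zero: "0 \<in> V" and gen: "x \<in> group_closure V"
  shows "l + (\<Sum>i<q. x) \<in> L \<longleftrightarrow> l \<in> L"
  using gen
proof (induction arbitrary: l rule: group_closure.induct)
  case (base s)
  have all: "y - (\<Sum>i<q. w) \<in> L" if "y - (\<Sum>i<q. v) \<in> L" "v \<in> V" "w \<in> V" for y v w
  proof -
    let ?S = "{v \<in> V. y - (\<Sum>i<q. v) \<in> L}"
    have "?S \<noteq> {}" "finite ?S" using that V by auto
    then have "card ?S > 0" by (simp add: card_gt_0_iff)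
    with tiling_prime_dilate[OF tiling q V] have "card V \<le> card ?S"
      using V by (auto intro: dvd_imp_le)
    then have "?S = V" using V(1) by (intro card_seteq) auto
    then show ?thesis using that by auto
  qed
  have "s \<in> V" using base zero by auto
  then show ?case
    using all[of "l + (\<Sum>i<q. s)" s 0] all[of "l + (\<Sum>i<q. s)" 0 s] zero by auto
next
  case (diff s t)
  have "l + (\<Sum>i<q. s - t) \<in> L \<longleftrightarrow> (l + (\<Sum>i<q. s - t)) + (\<Sum>i<q. t) \<in> L"
    using diff.IH(2) by simp
  also have "(l + (\<Sum>i<q. s - t)) + (\<Sum>i<q. t) = l + (\<Sum>i<q. s)"
    by (simp add: sum_subtractf)
  finally show ?case using diff.IH(1) by simp
qed

section \<open>Fourier analysis modulo a prime\<close>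

definition int_inner :: "int ^ 'n \<Rightarrow> int ^ 'n \<Rightarrow> int" where
  "int_inner a x = (\<Sum>j\<in>UNIV. a $ j * x $ j)"

lemma int_inner_0_left [simp]: "int_inner 0 x = 0"
  by (simp add: int_inner_def)

lemma int_inner_0_right [simp]: "int_inner a 0 = 0"
  by (simp add: int_inner_def)

lemma int_inner_add_right: "int_inner a (x + y) = int_inner a x + int_inner a y"
  by (simp add: int_inner_def sum.distrib algebra_simps)

lemma int_inner_diff_right: "int_inner a (x - y) = int_inner a x - int_inner a y"
  by (simp add: int_inner_def sum_subtractf algebra_simps)

lemma int_inner_commute: "int_inner a x = int_inner x a"
  by (simp add: int_inner_def mult.commute)

lemma int_inner_axis: "int_inner a (axis j 1) = a $ j"
  by (simp add: int_inner_def axis_def if_distrib cong: if_cong)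

lemma int_inner_sum_const: "int_inner a (\<Sum>i<q. y) = int q * int_inner a y"
  by (induction q) (simp_all add: int_inner_add_right algebra_simps)

section \<open>Additive characters modulo \<open>q\<close>\<close>

definition unity_char :: "nat \<Rightarrow> int \<Rightarrow> complex" where
  "unity_char q m = cis (2 * pi * real_of_int m / real q)"

lemma unity_char_0 [simp]: "unity_char q 0 = 1"
  by (simp add: unity_char_def)

lemma unity_char_add: "unity_char q (m + k) = unity_char q m * unity_char q k"
  by (simp add: unity_char_def cis_mult add_divide_distrib algebra_simps)

lemma unity_char_mult_period:
  assumes "q > 0"
  shows "unity_char q (int q * m) = 1"
  using assms cis_multiple_2pi[of "real_of_int m"] by (simp add: unity_char_def mult.assoc)

lemma unity_char_mod:
  assumes "q > 0"
  shows "unity_char q (m mod int q) = unity_char q m"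
  using unity_char_add[of q "m mod int q" "int q * (m div int q)"] assms
  by (simp add: unity_char_mult_period)

lemma unity_char_of_nat: "unity_char q (int k) = cis (2 * pi / real q) ^ k"
  by (simp add: unity_char_def DeMoivre mult.commute)

lemma unity_char_eq_1_iff:
  assumes "q > 0"
  shows "unity_char q m = 1 \<longleftrightarrow> int q dvd m"
proof
  assume "unity_char q m = 1"
  then have "cos (2 * pi * real_of_int m / real q) = 1"
    by (simp add: unity_char_def complex_eq_iff)
  then obtain n :: int where "2 * pi * real_of_int m / real q = of_int n * 2 * pi"
    using cos_one_2pi_int by auto
  then have "real_of_int m = real_of_int (n * int q)" using assms by (simp add: field_simps)
  then show "int q dvd m" by (simp only: of_int_eq_iff) simp
next
  assume "int q dvd m"
  then show "unity_char q m = 1" using assms by (auto simp: unity_char_mult_period)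
qed

text \<open>The box holds one representative of each class of Z^n modulo q Z^n, so summing a
  \<open>q\<close>-periodic function over it replaces a sum over the finite quotient.\<close>

definition int_box :: "nat \<Rightarrow> (int ^ 'n) set" where
  "int_box q = {x. \<forall>j. 0 \<le> x $ j \<and> x $ j < int q}"

definition vec_mod :: "nat \<Rightarrow> int ^ 'n \<Rightarrow> int ^ 'n" where
  "vec_mod q x = (\<chi> j. x $ j mod int q)"

lemma finite_int_box: "finite (int_box q :: (int ^ 'n) set)"
proof (rule finite_subset)
  show "int_box q \<subseteq> vec_lambda ` (PiE UNIV (\<lambda>_ :: 'n. {0..<int q}))"
  proof
    fix x :: "int ^ 'n" assume "x \<in> int_box q"
    then have "x = vec_lambda (vec_nth x)" "vec_nth x \<in> PiE UNIV (\<lambda>_. {0..<int q})"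
      by (auto simp: int_box_def)
    then show "x \<in> vec_lambda ` (PiE UNIV (\<lambda>_ :: 'n. {0..<int q}))" by (rule image_eqI)
  qed
qed (auto intro!: finite_imageI finite_PiE)

lemma vec_mod_in_box: "q > 0 \<Longrightarrow> vec_mod q x \<in> int_box q"
  by (simp add: vec_mod_def int_box_def)

lemma vec_mod_period:
  fixes x :: "int ^ 'n"
  shows "vec_mod q x + (\<Sum>i<q. (\<chi> j. x $ j div int q)) = x"
proof -
  have "(\<Sum>i<q. y) $ j = int q * y $ j" for y :: "int ^ 'n" and j
    by (simp only: sum_component) simp
  then show ?thesis by (simp add: vec_eq_iff vec_mod_def del: sum_constant sum_component)
qed

text \<open>Translation followed by reduction modulo \<open>q\<close> permutes the box, and
  periodicity makes the reduction invisible to \<open>f\<close>.\<close>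

lemma sum_int_box_translate:
  fixes f :: "int ^ 'n \<Rightarrow> 'b :: comm_monoid_add"
  assumes q: "q > 0" and per: "\<And>x y. f (x + (\<Sum>i<q. y)) = f x"
  shows "(\<Sum>x\<in>int_box q. f (x - t)) = (\<Sum>x\<in>int_box q. f x)"
proof (rule sum.reindex_bij_witness[where i = "\<lambda>x. vec_mod q (x + t)" and j = "\<lambda>x. vec_mod q (x - t)"])
  fix x :: "int ^ 'n" assume "x \<in> int_box q"
  then have x: "x $ j mod int q = x $ j" for j by (simp add: int_box_def)
  show "vec_mod q (vec_mod q (x - t) + t) = x" "vec_mod q (vec_mod q (x + t) - t) = x"
    by (simp_all add: vec_eq_iff vec_mod_def x mod_simps)
  show "vec_mod q (x - t) \<in> int_box q" "vec_mod q (x + t) \<in> int_box q"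
    using q by (simp_all add: vec_mod_in_box)
  show "f (vec_mod q (x - t)) = f (x - t)"
    using per[of "vec_mod q (x - t)"] by (metis vec_mod_period)
qed

lemma unity_char_inner_period:
  "q > 0 \<Longrightarrow> unity_char q (int_inner a (x + (\<Sum>i<q. y))) = unity_char q (int_inner a x)"
  by (simp add: int_inner_add_right int_inner_sum_const unity_char_add unity_char_mult_period
      del: sum_constant)

text \<open>Translating by the \<open>j\<close>-th unit vector multiplies the sum by
  \<open>unity_char q (a $ j)\<close>, which differs from 1.\<close>

lemma sum_int_box_unity_char:
  fixes a :: "int ^ 'n"
  assumes q: "q > 0" and a: "\<not> int q dvd a $ j"
  shows "(\<Sum>x\<in>int_box q. unity_char q (int_inner a x)) = 0"
proof -
  let ?S = "\<Sum>x\<in>int_box q. unity_char q (int_inner a x)"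
  have "?S = (\<Sum>x\<in>int_box q. unity_char q (int_inner a (x - (- axis j 1))))"
    by (rule sum_int_box_translate[symmetric]) (use q unity_char_inner_period in auto)
  also have "\<dots> = unity_char q (a $ j) * ?S"
    by (simp add: int_inner_add_right int_inner_axis unity_char_add sum_distrib_left mult.commute)
  finally show ?thesis using unity_char_eq_1_iff[OF q] a by simp
qed

text \<open>If no character sum over \<open>V\<close> vanished, the transform of \<open>L\<close>
  would vanish off 0. Inversion at a point of \<open>L\<close> then gives \<open>L\<close> full
  density in the box, whereas frequency 0 gives density 1/q.\<close>

lemma periodic_tiling_unity_char_zero:
  fixes V L :: "(int ^ 'n) set"
  assumes tiling: "tiling V L" and V: "finite V" "card V = q" and q: "q > 1"
    and per: "\<And>l x. l + (\<Sum>i<q. x) \<in> L \<longleftrightarrow> l \<in> L"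
  shows "\<exists>a. (\<Sum>v\<in>V. unity_char q (int_inner a v)) = 0"
proof (rule ccontr)
  assume "\<not> ?thesis"
  then have nz: "(\<Sum>v\<in>V. unity_char q (int_inner a v)) \<noteq> 0" for a by blast
  have q0: "q > 0" using q by simp
  let ?B = "int_box q :: (int ^ 'n) set"
  define g where "g x = (if x \<in> L then 1 else 0 :: complex)" for x
  have sum_g: "(\<Sum>v\<in>V. g (x - v)) = 1" for x
    using V(1) tiling_card_translate[OF tiling, of x] by (simp add: g_def sum.If_cases Int_def)
  define Lhat where "Lhat a = (\<Sum>x\<in>?B. g x * unity_char q (int_inner a x))" for a
  \<comment> \<open>The convolution theorem, applied to the constant 1 as the convolution of the
    indicators of \<open>V\<close> and \<open>L\<close>.\<close>
  have prod: "(\<Sum>v\<in>V. unity_char q (int_inner a v)) * Lhat a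
      = (\<Sum>x\<in>?B. unity_char q (int_inner a x))" for a
  proof -
    have "(\<Sum>x\<in>?B. unity_char q (int_inner a x))
        = (\<Sum>x\<in>?B. \<Sum>v\<in>V. g (x - v) * unity_char q (int_inner a x))"
      by (simp add: sum_g flip: sum_distrib_right)
    also have "\<dots> = (\<Sum>v\<in>V. \<Sum>x\<in>?B. g (x - v) * unity_char q (int_inner a x))"
      by (rule sum.swap)
    also have "\<dots> = (\<Sum>v\<in>V. unity_char q (int_inner a v) * Lhat a)"
    proof (rule sum.cong)
      fix v
      have "(\<Sum>x\<in>?B. g (x - v) * unity_char q (int_inner a x))
          = unity_char q (int_inner a v) * (\<Sum>x\<in>?B. g (x - v) * unity_char q (int_inner a (x - v)))"
        unfolding sum_distrib_left
        by (rule sum.cong) (simp_all flip: unity_char_add add: int_inner_diff_right mult.left_commute)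
      also have "(\<Sum>x\<in>?B. g (x - v) * unity_char q (int_inner a (x - v))) = Lhat a"
        unfolding Lhat_def
        by (rule sum_int_box_translate) (use q0 in \<open>auto simp: g_def per unity_char_inner_period simp del: sum_constant\<close>)
      finally show "(\<Sum>x\<in>?B. g (x - v) * unity_char q (int_inner a x))
          = unity_char q (int_inner a v) * Lhat a" .
    qed simp
    finally show ?thesis by (simp add: sum_distrib_right)
  qed
  have box_ndvd: "\<exists>j. \<not> int q dvd x $ j - y $ j" if xy: "x \<in> ?B" "y \<in> ?B" "x \<noteq> y" for x y
  proof -
    obtain j where j: "x $ j \<noteq> y $ j" using xy(3) by (auto simp: vec_eq_iff)
    have "x $ j mod int q \<noteq> y $ j mod int q" using xy j by (simp add: int_box_def)
    then have "\<not> int q dvd x $ j - y $ j" by (simp add: mod_eq_dvd_iff)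
    then show ?thesis ..
  qed
  have zeroB: "0 \<in> ?B" using q0 by (simp add: int_box_def)
  have Lhat0: "Lhat a = 0" if a: "a \<in> ?B" "a \<noteq> 0" for a
  proof -
    obtain j where "\<not> int q dvd a $ j" using box_ndvd[OF a(1) zeroB a(2)] by auto
    then show ?thesis using prod[of a] sum_int_box_unity_char[OF q0, of a j] nz[of a] by simp
  qed
  have "\<exists>l. l \<in> L" using tiling unfolding tiling_def by blast
  then obtain l where l: "l \<in> L" ..
  define m where "m = vec_mod q l"
  have m: "m \<in> ?B" "m \<in> L"
    using l per[of m "\<chi> j. l $ j div int q"] q0 unfolding m_def
    by (simp_all only: vec_mod_period vec_mod_in_box)
  \<comment> \<open>Fourier inversion at \<open>m\<close>: orthogonality leaves only
    \<open>x = m\<close>, while the vanishing of \<open>Lhat\<close> leaves only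
    \<open>a = 0\<close>.\<close>
  have "(\<Sum>a\<in>?B. Lhat a * unity_char q (int_inner a (- m)))
      = (\<Sum>x\<in>?B. g x * (\<Sum>a\<in>?B. unity_char q (int_inner (x - m) a)))"
    unfolding Lhat_def sum_distrib_right sum_distrib_left
    by (subst sum.swap)
       (simp add: mult.assoc int_inner_commute[of "_ - _"] flip: unity_char_add int_inner_add_right)
  also have "\<dots> = (\<Sum>x\<in>?B. if x = m then of_nat (card ?B) else 0)"
  proof (rule sum.cong)
    fix x assume x: "x \<in> ?B"
    show "g x * (\<Sum>a\<in>?B. unity_char q (int_inner (x - m) a)) = (if x = m then of_nat (card ?B) else 0)"
    proof (cases "x = m")
      case False
      then obtain j where "\<not> int q dvd (x - m) $ j" using box_ndvd[OF x m(1)] by auto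
      then show ?thesis using False sum_int_box_unity_char[OF q0, of "x - m" j] by simp
    qed (use m in \<open>simp add: g_def\<close>)
  qed simp
  also have "\<dots> = of_nat (card ?B)" using m by (simp add: finite_int_box)
  also have "(\<Sum>a\<in>?B. Lhat a * unity_char q (int_inner a (- m)))
      = (\<Sum>a\<in>{0}. Lhat a * unity_char q (int_inner a (- m)))"
    by (rule sum.mono_neutral_right) (use zeroB Lhat0 in \<open>auto simp: finite_int_box\<close>)
  finally have "Lhat 0 = of_nat (card ?B)" by simp
  moreover have "of_nat q * Lhat 0 = of_nat (card ?B)" using prod[of 0] V by simp
  moreover have "card ?B \<noteq> 0" using zeroB by (auto simp: finite_int_box card_eq_0_iff)
  ultimately show False using q by simp
qed

text \<open>Grouping the sum by residues of \<open>int_inner a\<close> gives a vanishing combination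
  of powers of a primitive root, so all residues occur equally often on \<open>V\<close>. With
  \<open>q\<close> elements and \<open>q\<close> residues each occurs once, and \<open>V\<close> is
  a transversal of the kernel.\<close>

lemma unity_char_sum_zero_imp_lattice_tiling:
  fixes V :: "(int ^ 'n) set"
  assumes q: "prime q" and V: "finite V" "card V = q"
    and zero: "(\<Sum>v\<in>V. unity_char q (int_inner a v)) = 0"
  shows "lattice_tiling V {x. int q dvd int_inner a x}"
proof -
  have q0: "q > 0" using prime_gt_0_nat[OF q] .
  define r where "r x = nat (int_inner a x mod int q)" for x
  have r: "r x < q" for x using q0 by (simp add: r_def nat_less_iff)
  have r_eq: "r x = r y \<longleftrightarrow> int q dvd int_inner a (x - y)" for x y
    using q0 by (simp add: r_def int_inner_diff_right mod_eq_dvd_iff[symmetric] eq_nat_nat_iff)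
  define c where "c i = card {v \<in> V. r v = i}" for i
  have "(\<Sum>i<q. of_int (int (c i)) * cis (2 * pi / real q) ^ i)
      = (\<Sum>i<q. \<Sum>v\<in>{v \<in> V. r v = i}. cis (2 * pi / real q) ^ r v)"
    by (rule sum.cong) (simp_all add: c_def)
  also have "\<dots> = (\<Sum>v\<in>V. cis (2 * pi / real q) ^ r v)"
    by (rule sum.group) (use V r in auto)
  also have "\<dots> = (\<Sum>v\<in>V. unity_char q (int_inner a v))"
    using q0 by (intro sum.cong) (simp_all add: r_def unity_char_mod flip: unity_char_of_nat)
  finally have eq: "c i = c (q - 1)" if "i < q" for i
    using vanishing_sum_prime_roots_of_unity[OF q, of "\<lambda>i. int (c i)" i] zero that by simp
  \<comment> \<open>Counting \<open>V\<close> by residues turns equal multiplicities into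
    multiplicity 1.\<close>
  have "q = (\<Sum>i<q. \<Sum>v\<in>{v \<in> V. r v = i}. 1)"
    using V r by (subst sum.group) auto
  also have "\<dots> = (\<Sum>i<q. c (q - 1))" 
  proof (rule sum.cong)
    fix i assume "i \<in> {..<q}"
    then show "(\<Sum>v\<in>{v \<in> V. r v = i}. 1) = c (q - 1)" using eq[of i] by (simp add: c_def)
  qed simp
  finally have "c (q - 1) = 1" using q0 by simp
  then have card1: "card {v \<in> V. r v = r x} = 1" for x using eq[OF r, of x] by (simp add: c_def)
  have "tiling V {x. int q dvd int_inner a x}"
    unfolding tiling_def
  proof
    fix x
    obtain v where "{v \<in> V. r v = r x} = {v}" using card1[of x] by (auto simp: card_1_singleton_iff)
    then have "w \<in> V \<and> r w = r x \<longleftrightarrow> w = v" for w by blast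
    then have v: "w \<in> V \<and> int q dvd int_inner a (x - w) \<longleftrightarrow> w = v" for w
      using r_eq[of x w] by metis
    show "\<exists>!p. p \<in> V \<times> {x. int q dvd int_inner a x} \<and> x = fst p + snd p"
    proof (rule ex1I[of _ "(v, x - v)"])
      show "(v, x - v) \<in> V \<times> {x. int q dvd int_inner a x} \<and> x = fst (v, x - v) + snd (v, x - v)"
        using v[of v] by simp
      fix p assume "p \<in> V \<times> {x. int q dvd int_inner a x} \<and> x = fst p + snd p"
      then show "p = (v, x - v)" using v[of "fst p"] by (cases p) auto
    qed
  qed
  moreover have "add_subgroup {x. int q dvd int_inner a x}"
    using int_inner_diff_right[of a 0] by (auto simp: add_subgroup_def int_inner_add_right)
  ultimately show ?thesis by (simp add: lattice_tiling_def)
qed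

theorem theorem19:
  fixes v :: "nat \<Rightarrow> int ^ 'n" and V :: "(int ^ 'n) set" and q :: nat
  assumes "V = insert 0 (v ` {1..q - 1})"
    and "card V = q"
    and "prime q"
    and "group_closure (v ` {1..q - 1}) = UNIV"
  shows "(\<exists>L. tiling V L) \<longleftrightarrow> (\<exists>L. lattice_tiling V L)"
proof
  assume "\<exists>L. tiling V L"
  then obtain L where L: "tiling V L" ..
  have V: "finite V" "0 \<in> V" and gen: "group_closure V = UNIV" using assms by auto
  have "l + (\<Sum>i<q. x) \<in> L \<longleftrightarrow> l \<in> L" for l x
    by (rule tiling_prime_periodic[OF L assms(3) V(1) assms(2) V(2)]) (simp add: gen)
  then obtain a where "(\<Sum>v\<in>V. unity_char q (int_inner a v)) = 0"
    using periodic_tiling_unity_char_zero[OF L V(1) assms(2) prime_gt_1_nat[OF assms(3)]] by blast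
  then show "\<exists>L. lattice_tiling V L"
    using unity_char_sum_zero_imp_lattice_tiling[OF assms(3) V(1) assms(2)] by blast
qed (auto simp: lattice_tiling_def)

end
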